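(* Let $(X,\tau)$ be a topological space, let $\mathbf{I}$ be a codense ideal on $X$, and let $(X,f)$ be a dynamical system. If $f$ is an open map, then every non-wandering point of $X$ is an $\mathbf{I}$-non-wandering point.
   Context: A dynamical system $(X,f)$ is a topological space $X$ together with a continuous map $f:X\to X$; $f^n$ is the $n$-th iterate of $f$. An ideal on $X$ is a nonempty collection $\mathbf{I}\subseteq 2^X$ closed under taking subsets and finite unions. $\mathbf{I}$ is codense if $\tau\cap\mathbf{I}=\{\varnothing\}$. A point $x\in X$ is non-wandering if for every neighbourhood $U$ of $x$ there is a positive integer $n$ with $f^n(U)\cap U\neq\varnothing$. A point $x\in X$ is $\mathbf{I}$-non-wandering if for every neighbourhood $M$ of $x$ there is a positive integer $n$ with $f^n(M)\cap M\notin\mathbf{I}$. *)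

theory Defs
  imports "HOL-Analysis.Analysis"
begin

definition dynamical_system :: "'a topology \<Rightarrow> ('a \<Rightarrow> 'a) \<Rightarrow> bool" where
  "dynamical_system X f \<longleftrightarrow> continuous_map X X f"

(* An ideal need not be proper: the whole space may belong to it. *)
definition set_ideal :: "'a set \<Rightarrow> 'a set set \<Rightarrow> bool" where
  "set_ideal S I \<longleftrightarrow> I \<subseteq> Pow S \<and> I \<noteq> {} \<and>
     (\<forall>A\<in>I. \<forall>B. B \<subseteq> A \<longrightarrow> B \<in> I) \<and>
     (\<forall>A\<in>I. \<forall>B\<in>I. A \<union> B \<in> I)"

definition codense :: "'a topology \<Rightarrow> 'a set set \<Rightarrow> bool" where
  "codense X I \<longleftrightarrow> {U. openin X U} \<inter> I = {{}}"

(* Neighbourhoods need not be open. *)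
definition neighbourhood_of :: "'a topology \<Rightarrow> 'a \<Rightarrow> 'a set \<Rightarrow> bool" where
  "neighbourhood_of X x M \<longleftrightarrow> M \<subseteq> topspace X \<and> (\<exists>U. openin X U \<and> x \<in> U \<and> U \<subseteq> M)"

definition non_wandering :: "'a topology \<Rightarrow> ('a \<Rightarrow> 'a) \<Rightarrow> 'a \<Rightarrow> bool" where
  "non_wandering X f x \<longleftrightarrow> x \<in> topspace X \<and>
     (\<forall>U. neighbourhood_of X x U \<longrightarrow> (\<exists>n>0. (f ^^ n) ` U \<inter> U \<noteq> {}))"

definition ideal_non_wandering ::
    "'a topology \<Rightarrow> 'a set set \<Rightarrow> ('a \<Rightarrow> 'a) \<Rightarrow> 'a \<Rightarrow> bool" where
  "ideal_non_wandering X I f x \<longleftrightarrow> x \<in> topspace X \<and>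
     (\<forall>M. neighbourhood_of X x M \<longrightarrow> (\<exists>n>0. (f ^^ n) ` M \<inter> M \<notin> I))"

end

theory Submission
  imports Defs
begin

text \<open>
  A return of an open neighbourhood \<open>U\<close> to itself under an iterate of an open map takes place
  along the set \<open>(f ^^ n) ` U \<inter> U\<close>, which is itself open. Codensity says that an open set is
  negligible only if it is empty, so a nonempty return is automatically a non-negligible one.
  A general neighbourhood \<open>M\<close> need not have an open image, so the argument is run on an open
  \<open>U \<subseteq> M\<close>; its conclusion passes to \<open>M\<close> because ideals are closed under subsets.
\<close>

lemma open_map_funpow:
  assumes "open_map X X f"
  shows "open_map X X (f ^^ n)"
proof (induction n)
  case 0
  then show ?case by (simp add: open_map_def)
next
  case (Suc n)
  then show ?case using assms by (simp only: funpow.simps(2) open_map_compose)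
qed

lemma codense_openin_notin:
  assumes "codense X I" "openin X U" "U \<noteq> {}"
  shows "U \<notin> I"
  using assms unfolding codense_def by blast

theorem theorem5p1:
  fixes X :: "'a topology" and I :: "'a set set" and f :: "'a \<Rightarrow> 'a"
  assumes "set_ideal (topspace X) I"
    and "codense X I"
    and "dynamical_system X f"
    and "open_map X X f"
  shows "\<forall>x\<in>topspace X. non_wandering X f x \<longrightarrow> ideal_non_wandering X I f x"
proof (intro ballI impI)
  fix x assume x: "x \<in> topspace X" and nw: "non_wandering X f x"
  have "\<exists>n>0. (f ^^ n) ` M \<inter> M \<notin> I" if M: "neighbourhood_of X x M" for M
  proof -
    obtain U where U: "openin X U" "x \<in> U" "U \<subseteq> M"
      using M unfolding neighbourhood_of_def by blast
    then have "neighbourhood_of X x U"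
      unfolding neighbourhood_of_def using openin_subset by blast
    then obtain n where n: "n > 0" and ne: "(f ^^ n) ` U \<inter> U \<noteq> {}"
      using nw unfolding non_wandering_def by blast
    have "openin X ((f ^^ n) ` U \<inter> U)"
      using open_map_funpow[OF assms(4), of n] U(1) unfolding open_map_def by blast
    then have "(f ^^ n) ` U \<inter> U \<notin> I"
      using codense_openin_notin[OF assms(2)] ne by blast
    moreover have "(f ^^ n) ` U \<inter> U \<subseteq> (f ^^ n) ` M \<inter> M"
      using U(3) by blast
    ultimately have "(f ^^ n) ` M \<inter> M \<notin> I"
      using assms(1) unfolding set_ideal_def by blast
    with n show ?thesis by blast
  qed
  with x show "ideal_non_wandering X I f x"
    unfolding ideal_non_wandering_def by blast
qed

end
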